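(* Equip $V$ with the $U^\vee_q$-module structure for which $z,Z,A$ act as $K,B,\mathbf{A}$, respectively. Then this $U^\vee_q$-module $V$ extends to a $U_q(\mathfrak{sl}_2)$-module. On the $U_q(\mathfrak{sl}_2)$-module $V$ we have $\nu_x=a^{-1}\psi$.
   Context: $\mathbb{F}$ is a field and $q\in\mathbb{F}$ is nonzero with $q^4\neq 1$. Tridiagonal pairs. Let $V$ be an $\mathbb{F}$-vector space of finite positive dimension. A tridiagonal pair on $V$ is an ordered pair of $\mathbb{F}$-linear maps $\mathbf{A},\mathbf{A}^*:V\to V$ such that: (i) each of $\mathbf{A},\mathbf{A}^*$ is diagonalizable; (ii) there is an ordering $\{V_i\}_{i=0}^d$ of the eigenspaces of $\mathbf{A}$ with $\mathbf{A}^*V_i\subseteq V_{i-1}+V_i+V_{i+1}$ for $0\le i\le d$ ($V_{-1}=V_{d+1}=0$); (iii) there is an ordering $\{V^*_i\}_{i=0}^\delta$ of the eigenspaces of $\mathbf{A}^*$ with $\mathbf{A}V^*_i\subseteq V^*_{i-1}+V^*_i+V^*_{i+1}$ for $0\le i\le\delta$ ($V^*_{-1}=V^*_{\delta+1}=0$); (iv) there is no subspace $W\subseteq V$ with $\mathbf{A}W\subseteq W$, $\mathbf{A}^*W\subseteq W$, $W\neq0$, $W\neq V$. It is known that $d=\delta$ (the diameter). Fix a tridiagonal pair $\mathbf{A},\mathbf{A}^*$ on $V$ with $d\ge1$, fix orderings $\{V_i\}_{i=0}^d$, $\{V^*_i\}_{i=0}^d$ satisfying (ii), (iii), and let $\theta_i,\theta^*_i$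 be the eigenvalues of $\mathbf{A},\mathbf{A}^*$ for $V_i,V^*_i$. Assume the pair has $q$-Racah type: there exist nonzero $a,b\in\mathbb{F}$ with $\theta_i=aq^{d-2i}+a^{-1}q^{2i-d}$ and $\theta^*_i=bq^{d-2i}+b^{-1}q^{2i-d}$ for $0\le i\le d$; fix these (then $a^2\neq1$). For $0\le i\le d$ let $$U_i=(V^*_0+\cdots+V^*_i)\cap(V_i+\cdots+V_d),\qquad U^\Downarrow_i=(V^*_0+\cdots+V^*_i)\cap(V_0+\cdots+V_{d-i}).$$ It is known that $V=\sum_{i=0}^dU_i$ and $V=\sum_{i=0}^dU^\Downarrow_i$ are direct sums. $K:V\to V$ (resp. $B:V\to V$) is the $\mathbb{F}$-linear map acting on $U_i$ (resp. $U^\Downarrow_i$) as $q^{d-2i}$ times the identity, for $0\le i\le d$; in particular $K,B$ are invertible. It is known that $aI-a^{-1}BK^{-1}$ is invertible. The (normalized) Bockting operator $\psi:V\to V$ is $$\psi=q^{-1}(I-BK^{-1})(aI-a^{-1}BK^{-1})^{-1}.$$ The algebra. $U_q(\mathfrak{sl}_2)$ is the $\mathbb{F}$-algebra with generators $x,y^{\pm1},z$ and relations $yy^{-1}=y^{-1}y=1$, $\frac{qxy-q^{-1}yx}{q-q^{-1}}=\frac{qyz-q^{-1}zy}{q-q^{-1}}=\frac{qzx-q^{-1}xz}{q-q^{-1}}=1$. $U^\vee_q$ is its (unital) subalgebra generated by $x,y^{-1},z$. With $a\in\mathbb{F}$ the fixed nonzero scalar satisfying $\theta_i=aq^{d-2i}+a^{-1}q^{2i-d}$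 for $0\le i\le d$, set $X=a^{-2}x+(1-a^{-2})y^{-1}$, $Z=a^2z+(1-a^2)y^{-1}$, $A=a^{-1}x+az=aX+a^{-1}Z$. The element $\nu_x\in U_q(\mathfrak{sl}_2)$ is $\nu_x=q(1-yz)=q^{-1}(1-zy)$. The algebra $U^\vee_q$ is generated by $z,Z,A$, and there is a unique $U^\vee_q$-module structure on $V$ for which $z,Z,A$ act as $K,B,\mathbf{A}$. *)

theory Defs
  imports Main "HOL-Library.Poly_Mapping" "HOL-Algebra.QuotRing" "HOL-Algebra.Generated_Rings"
begin

section \<open>Tridiagonal pairs\<close>

definition eigenspace ::
  "('f::field \<Rightarrow> 'v::ab_group_add \<Rightarrow> 'v) \<Rightarrow> ('v \<Rightarrow> 'v) \<Rightarrow> 'f \<Rightarrow> 'v set" where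
  "eigenspace scale T \<theta> = {v. T v = scale \<theta> v}"

definition eigenspaces ::
  "('f::field \<Rightarrow> 'v::ab_group_add \<Rightarrow> 'v) \<Rightarrow> ('v \<Rightarrow> 'v) \<Rightarrow> 'v set set" where
  "eigenspaces scale T = {eigenspace scale T \<theta> | \<theta>. eigenspace scale T \<theta> \<noteq> {0}}"

definition diagonalizable ::
  "('f::field \<Rightarrow> 'v::ab_group_add \<Rightarrow> 'v) \<Rightarrow> ('v \<Rightarrow> 'v) \<Rightarrow> bool" where
  "diagonalizable scale T \<longleftrightarrow> module.span scale (\<Union>(eigenspaces scale T)) = UNIV"

text \<open>Sums of subspaces are rendered as spans of unions. In the second conjunct the index set
  consists of those among \<open>i - 1\<close>, \<open>i\<close>, \<open>i + 1\<close> that lie in \<open>{0..d}\<close>, which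
  accounts for the convention that the spaces with index \<open>-1\<close> and \<open>d + 1\<close> are zero.\<close>

definition tridiagonal_ordering ::
  "('f::field \<Rightarrow> 'v::ab_group_add \<Rightarrow> 'v) \<Rightarrow> ('v \<Rightarrow> 'v) \<Rightarrow> ('v \<Rightarrow> 'v) \<Rightarrow> nat \<Rightarrow> (nat \<Rightarrow> 'v set) \<Rightarrow> bool" where
  "tridiagonal_ordering scale T T' d V \<longleftrightarrow>
     bij_betw V {..d} (eigenspaces scale T) \<and>
     (\<forall>i\<le>d. T' ` V i \<subseteq> module.span scale (\<Union>j\<in>{j. j \<le> d \<and> i \<le> j + 1 \<and> j \<le> i + 1}. V j))"

definition tridiagonal_pair ::
  "('f::field \<Rightarrow> 'v::ab_group_add \<Rightarrow> 'v) \<Rightarrow> ('v \<Rightarrow> 'v) \<Rightarrow> ('v \<Rightarrow> 'v) \<Rightarrow> bool" where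
  "tridiagonal_pair scale T T' \<longleftrightarrow>
     Vector_Spaces.linear scale scale T \<and> Vector_Spaces.linear scale scale T' \<and>
     diagonalizable scale T \<and> diagonalizable scale T' \<and>
     (\<exists>d V. tridiagonal_ordering scale T T' d V) \<and>
     (\<exists>\<delta> V'. tridiagonal_ordering scale T' T \<delta> V') \<and>
     \<not> (\<exists>W. module.subspace scale W \<and> T ` W \<subseteq> W \<and> T' ` W \<subseteq> W \<and> W \<noteq> {0} \<and> W \<noteq> UNIV)"

definition split_U ::
  "('f::field \<Rightarrow> 'v::ab_group_add \<Rightarrow> 'v) \<Rightarrow> nat \<Rightarrow> (nat \<Rightarrow> 'v set) \<Rightarrow> (nat \<Rightarrow> 'v set) \<Rightarrow> nat \<Rightarrow> 'v set" where
  "split_U scale d V V' i = module.span scale (\<Union>j\<in>{..i}. V' j) \<inter> module.span scale (\<Union>j\<in>{i..d}. V j)"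

definition split_U_down ::
  "('f::field \<Rightarrow> 'v::ab_group_add \<Rightarrow> 'v) \<Rightarrow> nat \<Rightarrow> (nat \<Rightarrow> 'v set) \<Rightarrow> (nat \<Rightarrow> 'v set) \<Rightarrow> nat \<Rightarrow> 'v set" where
  "split_U_down scale d V V' i = module.span scale (\<Union>j\<in>{..i}. V' j) \<inter> module.span scale (\<Union>j\<in>{..d - i}. V j)"

definition bockting ::
  "('f::field \<Rightarrow> 'v::ab_group_add \<Rightarrow> 'v) \<Rightarrow> 'f \<Rightarrow> 'f \<Rightarrow> ('v \<Rightarrow> 'v) \<Rightarrow> ('v \<Rightarrow> 'v) \<Rightarrow> 'v \<Rightarrow> 'v" where
  "bockting scale q a K B =
     (let R = (\<lambda>v. scale a v - scale (inverse a) (B (inv_into UNIV K v)));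
          N = (\<lambda>v. v - B (inv_into UNIV K v))
      in (\<lambda>v. scale (inverse q) (N (inv_into UNIV R v))))"

text \<open>The endomorphism ring, with composition as multiplication.\<close>

definition End_ring ::
  "('f::field \<Rightarrow> 'v::ab_group_add \<Rightarrow> 'v) \<Rightarrow> ('v \<Rightarrow> 'v) ring" where
  "End_ring scale = \<lparr>carrier = {f. Vector_Spaces.linear scale scale f},
     mult = (\<lambda>f g. f \<circ> g), one = id, zero = (\<lambda>v. 0), add = (\<lambda>f g v. f v + g v)\<rparr>"

section \<open>The free algebra on four generators\<close>

text \<open>Words form the free monoid; it is written additively because the ring structure that
  \<open>Poly_Mapping\<close> puts on finitely supported functions is the monoid algebra of an additive
  (not necessarily commutative) monoid.\<close>

datatype uq_gen = Gx | Gy | Gyinv | Gz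

datatype uq_word = Word (letters: "uq_gen list")

instantiation uq_word :: monoid_add
begin

definition zero_uq_word :: uq_word where "0 = Word []"

definition plus_uq_word :: "uq_word \<Rightarrow> uq_word \<Rightarrow> uq_word" where
  "u + w = Word (letters u @ letters w)"

instance
  by standard (simp_all add: zero_uq_word_def plus_uq_word_def)

end

type_synonym 'f uq_free = "uq_word \<Rightarrow>\<^sub>0 'f"

definition gen :: "uq_gen \<Rightarrow> ('f::field) uq_free" where
  "gen g = Poly_Mapping.single (Word [g]) 1"

definition scal :: "'f \<Rightarrow> ('f::field) uq_free" where
  "scal c = Poly_Mapping.single 0 c"

definition free_algebra :: "('f::field) uq_free ring" where
  "free_algebra = \<lparr>carrier = UNIV, mult = (*), one = 1, zero = 0, add = (+)\<rparr>"

lemma ring_free_algebra: "ring (free_algebra :: ('f::field) uq_free ring)"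
proof (rule ringI)
  show "abelian_group (free_algebra :: 'f uq_free ring)"
  proof (rule abelian_groupI)
    fix u :: "'f uq_free"
    show "\<exists>w\<in>carrier free_algebra. w \<oplus>\<^bsub>free_algebra\<^esub> u = \<zero>\<^bsub>free_algebra\<^esub>"
      by (rule bexI[of _ "- u"]) (simp_all add: free_algebra_def)
  qed (simp_all add: free_algebra_def algebra_simps)
  show "monoid (free_algebra :: 'f uq_free ring)"
    by (rule monoidI) (simp_all add: free_algebra_def algebra_simps)
qed (simp_all add: free_algebra_def algebra_simps)


section \<open>The algebra $U_q(sl_2)$ in its equitable presentation\<close>

definition uq_weyl :: "'f \<Rightarrow> uq_gen \<Rightarrow> uq_gen \<Rightarrow> ('f::field) uq_free" where
  "uq_weyl q g h = scal (inverse (q - inverse q)) *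
     (scal q * gen g * gen h - scal (inverse q) * gen h * gen g)"

definition uq_relators :: "'f \<Rightarrow> ('f::field) uq_free set" where
  "uq_relators q =
     {gen Gy * gen Gyinv - 1, gen Gyinv * gen Gy - 1,
      uq_weyl q Gx Gy - 1, uq_weyl q Gy Gz - 1, uq_weyl q Gz Gx - 1}"

definition uq_ideal :: "'f \<Rightarrow> ('f::field) uq_free set" where
  "uq_ideal q = genideal free_algebra (uq_relators q)"

definition Uq :: "'f \<Rightarrow> ('f::field) uq_free set ring" where
  "Uq q = free_algebra Quot (uq_ideal q)"

text \<open>The canonical projection from the free algebra; elements of \<^term>\<open>Uq q\<close> are
  written as \<open>uq_cls q p\<close> for a noncommutative polynomial \<open>p\<close> in the generators.\<close>

definition uq_cls :: "'f \<Rightarrow> ('f::field) uq_free \<Rightarrow> 'f uq_free set" where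
  "uq_cls q p = uq_ideal q +>\<^bsub>free_algebra\<^esub> p"

lemma ideal_uq_ideal: "ideal (uq_ideal q) free_algebra"
  unfolding uq_ideal_def
  by (rule ring.genideal_ideal[OF ring_free_algebra]) (simp add: free_algebra_def)

lemma ring_Uq: "ring (Uq q)"
  unfolding Uq_def by (rule ideal.quotient_is_ring[OF ideal_uq_ideal])

lemma uq_cls_ring_hom: "uq_cls q \<in> ring_hom free_algebra (Uq q)"
  using ideal.rcos_ring_hom[OF ideal_uq_ideal, of q] unfolding Uq_def uq_cls_def[abs_def] .

text \<open>The unital subalgebra generated by $x, y^{-1}, z$: the subring generated by these elements
  and all scalars.\<close>

definition Uq_vee :: "'f \<Rightarrow> ('f::field) uq_free set set" where
  "Uq_vee q = generate_ring (Uq q)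
     (range (\<lambda>c. uq_cls q (scal c)) \<union> {uq_cls q (gen Gx), uq_cls q (gen Gyinv), uq_cls q (gen Gz)})"

definition uq_z :: "'f \<Rightarrow> ('f::field) uq_free set" where
  "uq_z q = uq_cls q (gen Gz)"

definition uq_Z :: "'f \<Rightarrow> 'f \<Rightarrow> ('f::field) uq_free set" where
  "uq_Z q a = uq_cls q (scal (a\<^sup>2) * gen Gz + scal (1 - a\<^sup>2) * gen Gyinv)"

definition uq_A :: "'f \<Rightarrow> 'f \<Rightarrow> ('f::field) uq_free set" where
  "uq_A q a = uq_cls q (scal (inverse a) * gen Gx + scal a * gen Gz)"

definition uq_nu_x :: "'f \<Rightarrow> ('f::field) uq_free set" where
  "uq_nu_x q = uq_cls q (scal q * (1 - gen Gy * gen Gz))"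

text \<open>A module structure on the vector space for a subalgebra \<open>S\<close> of \<^term>\<open>Uq q\<close> is a
  homomorphism of algebras from \<open>S\<close> to the endomorphisms. Values of \<open>\<rho>\<close> outside \<open>S\<close>
  are irrelevant.\<close>

definition uq_module ::
  "('f::field \<Rightarrow> 'v::ab_group_add \<Rightarrow> 'v) \<Rightarrow> 'f \<Rightarrow> 'f uq_free set set \<Rightarrow> ('f uq_free set \<Rightarrow> 'v \<Rightarrow> 'v) \<Rightarrow> bool"
  where "uq_module scale q S \<rho> \<longleftrightarrow>
    \<rho> \<in> ring_hom (Uq q\<lparr>carrier := S\<rparr>) (End_ring scale) \<and>
    (\<forall>c. \<rho> (uq_cls q (scal c)) = scale c)"

end

theory Submission
  imports Defs
begin

text \<open>
  Write $L$ for the action of $y^{-1}$, so that $B = a^2 K + (1 - a^2) L$. The module extends to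
  $U_q(sl_2)$ as soon as $L$ is invertible. The relation between $z$ and $y^{-1}$ shows that
  $\ker L$ is $K$-invariant. The sums of the $U_i$ and of the $U^\Downarrow_i$ are invariant under
  the tridiagonal pair, hence equal to $V$ by irreducibility, so $K$ and $B$ are diagonalizable with
  known eigenspaces. If $\ker L \neq 0$, it contains an eigenvector $u$ of $K$; it is also one of
  $B$, because $B = a^2 K$ on $\ker L$. Hence $u \in U_i \cap U^\Downarrow_j$ with
  $a^2 = q^{2(i-j)}$. As the $\theta_i$ are distinct, this forces $\{i,j\} = \{0,d\}$, and then $u$
  is a common eigenvector of the tridiagonal pair, which is impossible for $d \geq 1$. Finally
  $BK^{-1} = a^2 + (1 - a^2) L K^{-1}$ turns $\psi$ into $a q^{-1} (1 - K L^{-1})$, the action of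
  $a q^{-1} (1 - zy) = a \nu_x$.
\<close>

section \<open>Split decompositions of a tridiagonal pair\<close>

text \<open>The value at \<open>T\<close> of the monic polynomial with root list \<open>cs\<close>,
  kept as a list of linear factors so that they can be peeled off one at a time.\<close>

abbreviation shifts ::
  "('f::field \<Rightarrow> 'v::ab_group_add \<Rightarrow> 'v) \<Rightarrow> ('v \<Rightarrow> 'v) \<Rightarrow> 'f list \<Rightarrow> 'v \<Rightarrow> 'v" where
  "shifts scale T cs \<equiv> foldr (\<lambda>c v. T v - scale c v) cs"

context vector_space
begin

section \<open>Eigenvectors of diagonalizable maps\<close>

lemma linear_in_span:
  assumes "Vector_Spaces.linear scale scale f" and "\<And>x. x \<in> S \<Longrightarrow> f x \<in> span T" and "v \<in> span S"
  shows "f v \<in> span T"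
proof -
  interpret f: Vector_Spaces.linear scale scale f by fact
  have "f ` span S = span (f ` S)" by (simp add: f.span_image)
  also have "\<dots> \<subseteq> span T" using assms(2) by (intro span_minimal) auto
  finally show ?thesis using assms(3) by blast
qed

lemma linear_shift:
  assumes "Vector_Spaces.linear scale scale T"
  shows "Vector_Spaces.linear scale scale (\<lambda>v. T v - scale c v)"
proof -
  interpret T: Vector_Spaces.linear scale scale T by fact
  show ?thesis
    by unfold_locales (simp_all add: T.add T.scale algebra_simps)
qed

lemma linear_shifts:
  assumes "Vector_Spaces.linear scale scale T"
  shows "Vector_Spaces.linear scale scale (shifts scale T cs)"
proof (induction cs)
  case Nil
  show ?case by unfold_locales simp_all
next
  case (Cons c cs)
  have "Vector_Spaces.linear scale scale ((\<lambda>v. T v - scale c v) \<circ> shifts scale T cs)"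
    by (rule Vector_Spaces.linear_compose[OF Cons linear_shift[OF assms]])
  then show ?case by (simp add: o_def)
qed

lemma shifts_eigenvector:
  assumes "Vector_Spaces.linear scale scale T" and "T v = scale t v"
  shows "shifts scale T cs v = scale (\<Prod>c\<leftarrow>cs. t - c) v"
proof -
  interpret T: Vector_Spaces.linear scale scale T by fact
  show ?thesis
    by (induction cs) (simp_all add: T.scale assms(2) algebra_simps)
qed

text \<open>The product of all factors \<open>T - c i\<close> kills every \<open>E i\<close>, hence
  the whole space. Applying its factors to \<open>w\<close> one by one stays inside
  \<open>W\<close>, and the last nonzero vector reached is an eigenvector.\<close>

lemma eigenvector_in_invariant_subspace:
  assumes T: "Vector_Spaces.linear scale scale T" and "finite I"
    and span: "span (\<Union>i\<in>I. E i) = UNIV"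
    and E: "\<And>i v. i \<in> I \<Longrightarrow> v \<in> E i \<Longrightarrow> T v = scale (c i) v"
    and W: "subspace W" "\<And>w. w \<in> W \<Longrightarrow> T w \<in> W" and w: "w \<in> W" "w \<noteq> 0"
  obtains u i where "u \<in> W" "u \<noteq> 0" "i \<in> I" "T u = scale (c i) u"
proof -
  obtain cs where cs: "set cs = c ` I"
    using finite_list[OF finite_imageI[OF \<open>finite I\<close>]] by metis
  have "shifts scale T cs v \<in> span {}" for v
  proof (rule linear_in_span[OF linear_shifts[OF T]])
    fix x assume "x \<in> (\<Union>i\<in>I. E i)"
    then obtain i where i: "i \<in> I" "x \<in> E i" by blast
    have "(\<Prod>t\<leftarrow>cs. c i - t) = 0"
      using i(1) cs by (auto simp: prod_list_zero_iff)
    then show "shifts scale T cs x \<in> span {}"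
      by (simp add: shifts_eigenvector[OF T E[OF i]])
  qed (simp add: span)
  then have "shifts scale T cs w = 0" by simp
  \<comment> \<open>\<open>foldr\<close> applies the last list entry first, so the induction removes
    factors from the end. Either \<open>w\<close> is already an eigenvector for that entry, or
    \<open>T w - scale t w\<close> is nonzero and is killed by the shorter list.\<close>
  moreover have "\<exists>u\<in>W. u \<noteq> 0 \<and> (\<exists>t\<in>set ts. T u = scale t u)"
    if "shifts scale T ts w = 0" "w \<in> W" "w \<noteq> 0" for ts w
    using that
  proof (induction ts arbitrary: w rule: rev_induct)
    case (snoc t ts)
    show ?case
    proof (cases "T w = scale t w")
      case True
      then show ?thesis using snoc.prems by auto
    next
      case False
      have "T w - scale t w \<in> W"
        using snoc.prems W by (intro subspace_diff subspace_scale) auto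
      then show ?thesis using snoc.IH[of "T w - scale t w"] snoc.prems False by auto
    qed
  qed simp
  ultimately show ?thesis using that cs w by fastforce
qed

text \<open>The product of the factors \<open>T - c i\<close> over all \<open>i\<close> other than
  \<open>k\<close> maps the whole space into \<open>E k\<close>. It multiplies \<open>w\<close> by a
  scalar that is nonzero because \<open>c\<close> is injective.\<close>

lemma eigenvector_in_component:
  assumes T: "Vector_Spaces.linear scale scale T" and "finite I"
    and span: "span (\<Union>i\<in>I. E i) = UNIV"
    and E: "\<And>i v. i \<in> I \<Longrightarrow> v \<in> E i \<Longrightarrow> T v = scale (c i) v"
    and sub: "\<And>i. i \<in> I \<Longrightarrow> subspace (E i)"
    and inj: "inj_on c I" and k: "k \<in> I" and w: "T w = scale (c k) w"
  shows "w \<in> E k"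
proof -
  obtain cs where cs: "set cs = c ` (I - {k})"
    using finite_list[OF finite_imageI[OF finite_Diff[OF \<open>finite I\<close>]]] by metis
  have "shifts scale T cs w \<in> span (E k)"
  proof (rule linear_in_span[OF linear_shifts[OF T]])
    fix x assume "x \<in> (\<Union>i\<in>I. E i)"
    then obtain i where i: "i \<in> I" "x \<in> E i" by blast
    have "(\<Prod>t\<leftarrow>cs. c i - t) = 0" if "i \<noteq> k"
      using i(1) cs that by (auto simp: prod_list_zero_iff)
    then show "shifts scale T cs x \<in> span (E k)"
      using i by (cases "i = k") (auto simp: shifts_eigenvector[OF T E[OF i]] span_zero span_base span_scale)
  qed (simp add: span)
  then have "scale (\<Prod>t\<leftarrow>cs. c k - t) w \<in> E k"
    using span_eq_iff[THEN iffD2, OF sub[OF k]] by (simp add: shifts_eigenvector[OF T w])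
  moreover have "c k \<notin> set cs"
    using inj_on_image_mem_iff[OF inj k, of "I - {k}"] cs by blast
  then have "(\<Prod>t\<leftarrow>cs. c k - t) \<noteq> 0"
    by (auto simp: prod_list_zero_iff)
  ultimately show ?thesis
    using subspace_scale[OF sub[OF k], of "scale (\<Prod>t\<leftarrow>cs. c k - t) w" "inverse (\<Prod>t\<leftarrow>cs. c k - t)"]
    by simp
qed

text \<open>A nonzero kernel is an invariant subspace, so it would contain an eigenvector for some
  \<open>c i\<close>, forcing \<open>c i = 0\<close>. Each \<open>E i\<close> lies in the range
  because \<open>T\<close> only rescales its vectors by nonzero scalars.\<close>

lemma bij_of_nonzero_eigenvalues:
  assumes T: "Vector_Spaces.linear scale scale T" and "finite I"
    and span: "span (\<Union>i\<in>I. E i) = UNIV"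
    and E: "\<And>i v. i \<in> I \<Longrightarrow> v \<in> E i \<Longrightarrow> T v = scale (c i) v"
    and nz: "\<And>i. i \<in> I \<Longrightarrow> c i \<noteq> 0"
  shows "bij T"
proof (rule bijI)
  interpret T: Vector_Spaces.linear scale scale T by fact
  show "inj T"
  proof (rule ccontr)
    assume "\<not> inj T"
    then obtain w where w: "T w = 0" "w \<noteq> 0"
      using T.inj_iff_eq_0 by blast
    have ker: "subspace {v. T v = 0}" by (rule T.subspace_kernel)
    obtain u i where "u \<in> {v. T v = 0}" "u \<noteq> 0" "i \<in> I" "T u = scale (c i) u"
      by (rule eigenvector_in_invariant_subspace[where w = w, OF T \<open>finite I\<close> span E ker])
        (simp_all add: w T.zero)
    then show False using nz by simp
  qed
  have "span (\<Union>i\<in>I. E i) \<subseteq> range T"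
  proof (rule span_minimal)
    show "subspace (range T)" by (rule T.subspace_image[OF subspace_UNIV])
    show "(\<Union>i\<in>I. E i) \<subseteq> range T"
    proof
      fix x assume "x \<in> (\<Union>i\<in>I. E i)"
      then obtain i where i: "i \<in> I" "x \<in> E i" by blast
      have "x = T (scale (inverse (c i)) x)"
        using nz[OF i(1)] by (simp add: T.scale E[OF i])
      then show "x \<in> range T" by blast
    qed
  qed
  then show "surj T" using span by blast
qed

section \<open>Tridiagonal orderings and split decompositions\<close>

lemma subspace_split_U: "subspace (split_U scale d V V' i)"
  unfolding split_U_def by (intro subspace_inter subspace_span)

lemma tridiagonal_ordering_span:
  assumes "diagonalizable scale T" and "tridiagonal_ordering scale T T' d V"
  shows "span (\<Union>i\<le>d. V i) = UNIV"
proof -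
  have "V ` {..d} = eigenspaces scale T"
    using assms(2) unfolding tridiagonal_ordering_def by (simp add: bij_betw_imp_surj_on)
  then show ?thesis using assms(1) unfolding diagonalizable_def by simp
qed

lemma tridiagonal_ordering_nonzero:
  assumes "tridiagonal_ordering scale T T' d V" and "i \<le> d"
  shows "V i \<noteq> {0}"
proof -
  have "V i \<in> eigenspaces scale T"
    using assms bij_betwE[of V "{..d}"] unfolding tridiagonal_ordering_def by simp
  then show ?thesis unfolding eigenspaces_def by auto
qed

text \<open>The map sending \<open>i\<close> to \<open>d - i\<close> preserves adjacency of indices.
  Reversing the ordering lets one argument about \<open>split_U\<close> also serve
  \<open>split_U_down\<close>.\<close>

lemma tridiagonal_ordering_rev:
  assumes "tridiagonal_ordering scale T T' d V"
  shows "tridiagonal_ordering scale T T' d (\<lambda>i. V (d - i))"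
proof -
  have rev: "bij_betw (\<lambda>i. d - i) {..d} {..d}"
    by (rule bij_betw_byWitness[where f' = "\<lambda>i. d - i"]) auto
  have "T' ` V (d - i) \<subseteq> span (\<Union>j\<in>{j. j \<le> d \<and> i \<le> j + 1 \<and> j \<le> i + 1}. V (d - j))"
    if i: "i \<le> d" for i
  proof -
    have "T' ` V (d - i) \<subseteq> span (\<Union>j\<in>{j. j \<le> d \<and> d - i \<le> j + 1 \<and> j \<le> d - i + 1}. V j)"
      using assms unfolding tridiagonal_ordering_def by simp
    also have "\<dots> \<subseteq> span (\<Union>j\<in>{j. j \<le> d \<and> i \<le> j + 1 \<and> j \<le> i + 1}. V (d - j))"
    proof (intro span_mono subsetI)
      fix x assume "x \<in> (\<Union>j\<in>{j. j \<le> d \<and> d - i \<le> j + 1 \<and> j \<le> d - i + 1}. V j)"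
      then obtain j where "j \<le> d" "d - i \<le> j + 1" "j \<le> d - i + 1" "x \<in> V j" by blast
      then show "x \<in> (\<Union>j\<in>{j. j \<le> d \<and> i \<le> j + 1 \<and> j \<le> i + 1}. V (d - j))"
        using i by (intro UN_I[of "d - j"]) auto
    qed
    finally show ?thesis .
  qed
  moreover have "bij_betw (\<lambda>i. V (d - i)) {..d} (eigenspaces scale T)"
    using bij_betw_trans[OF rev, of V] assms unfolding tridiagonal_ordering_def by (simp add: o_def)
  ultimately show ?thesis unfolding tridiagonal_ordering_def by blast
qed

lemma split_U_rev:
  assumes "i \<le> d"
  shows "split_U scale d (\<lambda>j. V (d - j)) V' i = split_U_down scale d V V' i"
proof -
  have "k \<in> (\<lambda>j. d - j) ` {i..d}" if "k \<le> d - i" for k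
    using that assms by (intro image_eqI[of _ _ "d - k"]) auto
  then have "(\<lambda>j. d - j) ` {i..d} = {..d - i}" by auto
  then have "(\<Union>j\<in>{i..d}. V (d - j)) = (\<Union>j\<in>{..d - i}. V j)"
    by (metis image_image)
  then show ?thesis unfolding split_U_def split_U_down_def by simp
qed

text \<open>On the i-th component, \<open>A\<close> minus its i-th eigenvalue raises the index by
  one and \<open>A'\<close> minus its i-th eigenvalue lowers it by one. The sum is therefore
  invariant under both maps, and irreducibility makes it everything once it is seen to be
  nonzero.\<close>

lemma split_U_span:
  assumes pair: "tridiagonal_pair scale A A'"
    and VA: "tridiagonal_ordering scale A A' d V"
    and VA': "tridiagonal_ordering scale A' A d V'"
    and V: "\<And>i. i \<le> d \<Longrightarrow> V i = eigenspace scale A (\<theta> i)"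
    and V': "\<And>i. i \<le> d \<Longrightarrow> V' i = eigenspace scale A' (\<theta>' i)"
  shows "span (\<Union>i\<le>d. split_U scale d V V' i) = UNIV"
proof -
  let ?U = "split_U scale d V V'"
  let ?W = "span (\<Union>i\<le>d. ?U i)"
  have lin: "Vector_Spaces.linear scale scale A" "Vector_Spaces.linear scale scale A'"
    using pair unfolding tridiagonal_pair_def by blast+
  interpret A: Vector_Spaces.linear scale scale A by fact
  interpret A': Vector_Spaces.linear scale scale A' by fact
  have AV: "A v = scale (\<theta> i) v" if "i \<le> d" "v \<in> V i" for i v
    using V that unfolding eigenspace_def by blast
  have AV': "A' v = scale (\<theta>' i) v" if "i \<le> d" "v \<in> V' i" for i v
    using V' that unfolding eigenspace_def by blast
  have tri: "A' v \<in> span (\<Union>j\<in>{j. j \<le> d \<and> i \<le> j + 1 \<and> j \<le> i + 1}. V j)"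
    if "i \<le> d" "v \<in> V i" for i v
    using VA that unfolding tridiagonal_ordering_def by blast
  have tri': "A v \<in> span (\<Union>j\<in>{j. j \<le> d \<and> i \<le> j + 1 \<and> j \<le> i + 1}. V' j)"
    if "i \<le> d" "v \<in> V' i" for i v
    using VA' that unfolding tridiagonal_ordering_def by blast
  \<comment> \<open>The shift annihilates \<open>V i\<close> and rescales each later eigenspace. For
    \<open>i = d\<close> the target is the span of the empty set, that is, zero.\<close>
  have raise: "A u - scale (\<theta> i) u \<in> span (\<Union>j\<in>{i+1..d}. V j)"
    if u: "u \<in> span (\<Union>j\<in>{i..d}. V j)" for i u
  proof (rule linear_in_span[OF linear_shift[OF lin(1)] _ u])
    fix x assume "x \<in> (\<Union>j\<in>{i..d}. V j)"
    then obtain j where j: "i \<le> j" "j \<le> d" "x \<in> V j" by auto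
    show "A x - scale (\<theta> i) x \<in> span (\<Union>j\<in>{i+1..d}. V j)"
    proof (cases "j = i")
      case False
      then have "x \<in> span (\<Union>j\<in>{i+1..d}. V j)"
        using j by (intro span_base) auto
      then show ?thesis
        by (simp add: AV[OF j(2,3)] span_scale span_diff)
    qed (use AV[OF j(2,3)] in \<open>simp add: span_zero\<close>)
  qed
  have lower: "A' u - scale (\<theta>' i) u \<in> span (\<Union>j\<in>{..<i}. V' j)"
    if u: "u \<in> span (\<Union>j\<in>{..i}. V' j)" and i: "i \<le> d" for i u
  proof (rule linear_in_span[OF linear_shift[OF lin(2)] _ u])
    fix x assume "x \<in> (\<Union>j\<in>{..i}. V' j)"
    then obtain j where j: "j \<le> i" "x \<in> V' j" by auto
    show "A' x - scale (\<theta>' i) x \<in> span (\<Union>j\<in>{..<i}. V' j)"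
    proof (cases "j = i")
      case False
      then have "x \<in> span (\<Union>j\<in>{..<i}. V' j)"
        using j by (intro span_base) auto
      then show ?thesis
        using AV'[of j x] i j by (simp add: span_scale span_diff)
    qed (use AV'[of j x] i j in \<open>simp add: span_zero\<close>)
  qed
  \<comment> \<open>Here only the tridiagonal condition matters: \<open>A'\<close> lowers the index
    by at most one, and subtracting a multiple of \<open>u\<close> is harmless. At
    \<open>i = 0\<close> truncated subtraction keeps the range starting at 0, as it should.\<close>
  have lower2: "A' u - scale (\<theta>' i) u \<in> span (\<Union>j\<in>{i-1..d}. V j)"
    if u: "u \<in> span (\<Union>j\<in>{i..d}. V j)" for i u
  proof (rule linear_in_span[OF linear_shift[OF lin(2)] _ u])
    fix x assume "x \<in> (\<Union>j\<in>{i..d}. V j)"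
    then obtain j where j: "i \<le> j" "j \<le> d" "x \<in> V j" by auto
    have "span (\<Union>k\<in>{k. k \<le> d \<and> j \<le> k + 1 \<and> k \<le> j + 1}. V k) \<subseteq> span (\<Union>j\<in>{i-1..d}. V j)"
      using j by (intro span_mono UN_mono) auto
    moreover have "x \<in> span (\<Union>j\<in>{i-1..d}. V j)"
      using j by (intro span_base) auto
    ultimately show "A' x - scale (\<theta>' i) x \<in> span (\<Union>j\<in>{i-1..d}. V j)"
      using tri[OF j(2,3)] by (intro span_diff span_scale) auto
  qed
  have raise2: "A u - scale (\<theta> i) u \<in> span (\<Union>j\<in>{..i+1}. V' j)"
    if u: "u \<in> span (\<Union>j\<in>{..i}. V' j)" and i: "i \<le> d" for i u
  proof (rule linear_in_span[OF linear_shift[OF lin(1)] _ u])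
    fix x assume "x \<in> (\<Union>j\<in>{..i}. V' j)"
    then obtain j where j: "j \<le> i" "x \<in> V' j" by auto
    have "span (\<Union>k\<in>{k. k \<le> d \<and> j \<le> k + 1 \<and> k \<le> j + 1}. V' k) \<subseteq> span (\<Union>j\<in>{..i+1}. V' j)"
      using j by (intro span_mono UN_mono) auto
    moreover have "x \<in> span (\<Union>j\<in>{..i+1}. V' j)"
      using j by (intro span_base) auto
    ultimately show "A x - scale (\<theta> i) x \<in> span (\<Union>j\<in>{..i+1}. V' j)"
      using tri'[OF _ j(2)] i j by (intro span_diff span_scale) auto
  qed
  have U_W: "v \<in> ?W" if "i \<le> d" "v \<in> ?U i" for i v
    using that by (intro span_base) auto
  have "A u \<in> ?W" if i: "i \<le> d" and u: "u \<in> ?U i" for i u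
  proof -
    have "A u - scale (\<theta> i) u \<in> ?W"
    proof (cases "i = d")
      case True
      then show ?thesis using raise[of u i] u by (simp add: split_U_def span_zero)
    next
      case False
      have "A u - scale (\<theta> i) u \<in> ?U (i + 1)"
        using raise[of u i] raise2[of u i] u i unfolding split_U_def by blast
      then show ?thesis using U_W[of "i + 1"] i False by simp
    qed
    from span_add[OF this span_scale[OF U_W[OF i u], of "\<theta> i"]] show ?thesis by simp
  qed
  then have "A v \<in> ?W" if "v \<in> ?W" for v
    by (intro linear_in_span[OF lin(1) _ that]) blast
  then have A_W: "A ` ?W \<subseteq> ?W" by blast
  have "A' u \<in> ?W" if i: "i \<le> d" and u: "u \<in> ?U i" for i u
  proof -
    have "A' u - scale (\<theta>' i) u \<in> ?W"
    proof (cases "i = 0")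
      case True
      then show ?thesis using lower[of u i] u by (simp add: split_U_def span_zero)
    next
      case False
      then have "{..<i} = {..i - 1}" by auto
      then have "A' u - scale (\<theta>' i) u \<in> ?U (i - 1)"
        using lower[of u i] lower2[of u i] u i unfolding split_U_def by auto
      then show ?thesis using U_W[of "i - 1"] i by simp
    qed
    from span_add[OF this span_scale[OF U_W[OF i u], of "\<theta>' i"]] show ?thesis by simp
  qed
  then have "A' v \<in> ?W" if "v \<in> ?W" for v
    by (intro linear_in_span[OF lin(2) _ that]) blast
  then have A'_W: "A' ` ?W \<subseteq> ?W" by blast
  have "diagonalizable scale A" using pair unfolding tridiagonal_pair_def by blast
  from tridiagonal_ordering_span[OF this VA] have "span (\<Union>i\<le>d. V i) = UNIV" .
  \<comment> \<open>For index 0 the second factor of the intersection is the whole space, so the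
    nonzero eigenspace \<open>V' 0\<close> witnesses that the sum is nonzero.\<close>
  then have "V' 0 \<subseteq> ?U 0"
    by (auto simp: split_U_def atLeast0AtMost span_base)
  then have "V' 0 \<subseteq> ?W" using U_W[of 0] by blast
  moreover have "0 \<in> V' 0" using V'[of 0] by (simp add: eigenspace_def)
  ultimately have "?W \<noteq> {0}"
    using tridiagonal_ordering_nonzero[OF VA', of 0] by auto
  moreover have "subspace ?W" by (rule subspace_span)
  ultimately show ?thesis
    using pair A_W A'_W unfolding tridiagonal_pair_def by blast
qed

end

section \<open>Modules for the equitable presentation\<close>

lemma scal_1: "scal 1 = 1"
  by (simp add: scal_def)

lemma scal_uminus: "scal (- c) = - scal c"
  by (simp add: scal_def single_uminus)

lemma gen_scal_commute: "gen g * scal c = scal c * gen g"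
  by (simp add: gen_def scal_def mult_single)

lemma gen_scal_left_commute: "gen g * (scal c * p) = scal c * (gen g * p)"
  by (metis gen_scal_commute mult.assoc)

lemma free_algebra_simps [simp]:
  "carrier free_algebra = UNIV" "p \<otimes>\<^bsub>free_algebra\<^esub> p' = p * p'"
  "p \<oplus>\<^bsub>free_algebra\<^esub> p' = p + p'" "\<one>\<^bsub>free_algebra\<^esub> = 1" "\<zero>\<^bsub>free_algebra\<^esub> = 0"
  by (simp_all add: free_algebra_def)

lemma uq_relators_subset_ideal: "uq_relators q \<subseteq> uq_ideal q"
  unfolding uq_ideal_def by (rule ring.genideal_self[OF ring_free_algebra]) simp

lemma uq_ideal_add: "p \<in> uq_ideal q \<Longrightarrow> p' \<in> uq_ideal q \<Longrightarrow> p + p' \<in> uq_ideal q"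
  using additive_subgroup.a_closed[OF ideal.axioms(1)[OF ideal_uq_ideal], of p q p'] by simp

lemma uq_ideal_mult_left: "p \<in> uq_ideal q \<Longrightarrow> p' * p \<in> uq_ideal q"
  using ideal.I_l_closed[OF ideal_uq_ideal, of p q p'] by simp

lemma uq_ideal_mult_right: "p \<in> uq_ideal q \<Longrightarrow> p * p' \<in> uq_ideal q"
  using ideal.I_r_closed[OF ideal_uq_ideal, of p q p'] by simp

lemma uq_ideal_diff: "p \<in> uq_ideal q \<Longrightarrow> p' \<in> uq_ideal q \<Longrightarrow> p - p' \<in> uq_ideal q"
  using uq_ideal_add[of p q "- 1 * p'"] uq_ideal_mult_left[of p' q "- 1"] by simp

lemma uq_cls_add: "uq_cls q (p + p') = uq_cls q p \<oplus>\<^bsub>Uq q\<^esub> uq_cls q p'"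
  using ring_hom_add[OF uq_cls_ring_hom, of p p' q] by simp

lemma uq_cls_mult: "uq_cls q (p * p') = uq_cls q p \<otimes>\<^bsub>Uq q\<^esub> uq_cls q p'"
  using ring_hom_mult[OF uq_cls_ring_hom, of p p' q] by simp

lemma uq_cls_1: "uq_cls q 1 = \<one>\<^bsub>Uq q\<^esub>"
  using ring_hom_one[OF uq_cls_ring_hom, of q] by simp

lemma uq_cls_0: "uq_cls q 0 = \<zero>\<^bsub>Uq q\<^esub>"
  using ring_hom_zero[OF uq_cls_ring_hom ring_free_algebra ring_Uq, of q] by simp

lemma carrier_Uq: "carrier (Uq q) = range (uq_cls q)"
  by (auto simp: Uq_def FactRing_def A_RCOSETS_def' uq_cls_def)

lemma uq_cls_uminus: "uq_cls q (- p) = \<ominus>\<^bsub>Uq q\<^esub> uq_cls q p"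
proof -
  interpret ring "Uq q" by (rule ring_Uq)
  have "uq_cls q (- p) \<oplus>\<^bsub>Uq q\<^esub> uq_cls q p = \<zero>\<^bsub>Uq q\<^esub>"
    by (simp flip: uq_cls_add uq_cls_0)
  then show ?thesis
    using minus_equality by (simp add: carrier_Uq)
qed

lemma uq_cls_eq_0_iff: "uq_cls q p = \<zero>\<^bsub>Uq q\<^esub> \<longleftrightarrow> p \<in> uq_ideal q"
proof -
  have zero: "\<zero>\<^bsub>Uq q\<^esub> = uq_ideal q" by (simp add: Uq_def FactRing_def)
  have "abelian_subgroup (uq_ideal q) free_algebra"
    by (rule abelian_subgroupI3[OF ideal.axioms(1)[OF ideal_uq_ideal] ring.is_abelian_group[OF ring_free_algebra]])
  then show ?thesis
    using ideal.rcos_const_imp_mem[OF ideal_uq_ideal, of p q]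
    by (auto simp: zero uq_cls_def abelian_subgroup.a_rcos_const)
qed

text \<open>Reduces identities in the quotient to ideal membership, which can then be certified by
  explicit combinations of relators.\<close>

lemma uq_cls_eq_iff: "uq_cls q p = uq_cls q p' \<longleftrightarrow> p - p' \<in> uq_ideal q"
proof -
  interpret ring "Uq q" by (rule ring_Uq)
  have car: "uq_cls q r \<in> carrier (Uq q)" for r by (simp add: carrier_Uq)
  have "uq_cls q (p - p') = uq_cls q p \<ominus>\<^bsub>Uq q\<^esub> uq_cls q p'"
    using uq_cls_add[of q p "- p'"] by (simp add: uq_cls_uminus a_minus_def)
  then show ?thesis
    by (simp add: r_right_minus_eq car flip: uq_cls_eq_0_iff)
qed

lemma uq_cls_relator: "p - p' \<in> uq_relators q \<Longrightarrow> uq_cls q p = uq_cls q p'"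
  using uq_relators_subset_ideal uq_cls_eq_iff by blast

lemma
  shows uq_cls_y_yinv: "uq_cls q (gen Gy * gen Gyinv) = uq_cls q 1"
    and uq_cls_weyl_zx: "uq_cls q (uq_weyl q Gz Gx) = uq_cls q 1"
  by (auto intro!: uq_cls_relator simp: uq_relators_def)

text \<open>The generators of \<open>Uq_vee\<close> do not include \<open>Gy\<close>, so a module
  over it uses the relation between x and y in a form that involves only the inverse of y.\<close>

lemma uq_cls_weyl_x_yinv:
  "uq_cls q (uq_weyl q Gyinv Gx) = uq_cls q (gen Gyinv * gen Gyinv)"
proof -
  let ?s = "scal (inverse (q - inverse q))" and ?y = "gen Gy" and ?L = "gen Gyinv" and ?x = "gen Gx"
  have rel: "?y * ?L - 1 \<in> uq_ideal q" "?L * ?y - 1 \<in> uq_ideal q" "uq_weyl q Gx Gy - 1 \<in> uq_ideal q"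
    using uq_relators_subset_ideal[of q] by (auto simp: uq_relators_def)
  \<comment> \<open>The relation for $x, y$, multiplied by $y^{-1}$ on both sides.\<close>
  have "uq_weyl q Gyinv Gx - ?L * ?L = ?L * (uq_weyl q Gx Gy - 1) * ?L
      - ?s * scal q * ?L * ?x * (?y * ?L - 1) + ?s * scal (inverse q) * (?L * ?y - 1) * ?x * ?L"
    by (simp add: uq_weyl_def algebra_simps gen_scal_commute gen_scal_left_commute)
  also have "\<dots> \<in> uq_ideal q"
    by (simp only: mult.assoc)
      (intro uq_ideal_add uq_ideal_diff uq_ideal_mult_left uq_ideal_mult_right rel)
  finally show ?thesis by (simp add: uq_cls_eq_iff)
qed

lemma uq_cls_weyl_yinv_z:
  "uq_cls q (uq_weyl q Gz Gyinv) = uq_cls q (gen Gyinv * gen Gyinv)"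
proof -
  let ?s = "scal (inverse (q - inverse q))" and ?y = "gen Gy" and ?L = "gen Gyinv" and ?z = "gen Gz"
  have rel: "?y * ?L - 1 \<in> uq_ideal q" "?L * ?y - 1 \<in> uq_ideal q" "uq_weyl q Gy Gz - 1 \<in> uq_ideal q"
    using uq_relators_subset_ideal[of q] by (auto simp: uq_relators_def)
  \<comment> \<open>The relation for y and z is multiplied by the inverse of y on both sides. The
    two remaining summands replace \<open>?L * ?y\<close> and \<open>?y * ?L\<close> by 1.\<close>
  have "uq_weyl q Gz Gyinv - ?L * ?L = ?L * (uq_weyl q Gy Gz - 1) * ?L
      - ?s * scal q * (?L * ?y - 1) * ?z * ?L + ?s * scal (inverse q) * ?L * ?z * (?y * ?L - 1)"
    by (simp add: uq_weyl_def algebra_simps gen_scal_commute gen_scal_left_commute)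
  also have "\<dots> \<in> uq_ideal q"
    by (simp only: mult.assoc)
      (intro uq_ideal_add uq_ideal_diff uq_ideal_mult_left uq_ideal_mult_right rel)
  finally show ?thesis by (simp add: uq_cls_eq_iff)
qed

section \<open>Evaluation rules for modules\<close>

lemma Uq_vee_scal: "uq_cls q (scal c) \<in> Uq_vee q"
  and Uq_vee_x: "uq_cls q (gen Gx) \<in> Uq_vee q"
  and Uq_vee_yinv: "uq_cls q (gen Gyinv) \<in> Uq_vee q"
  and Uq_vee_z: "uq_cls q (gen Gz) \<in> Uq_vee q"
  unfolding Uq_vee_def by (auto intro: generate_ring.incl)

lemma subring_Uq_vee: "subring (Uq_vee q) (Uq q)"
  unfolding Uq_vee_def by (rule ring.generate_ring_is_subring[OF ring_Uq]) (auto simp: carrier_Uq)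

text \<open>The subring \<open>S\<close> is left general so that the same rules apply to
  \<open>Uq_vee q\<close> and to the full algebra.\<close>

context
  fixes scale :: "'f::field \<Rightarrow> 'v::ab_group_add \<Rightarrow> 'v" and q :: 'f and S and \<rho>
  assumes S: "subring S (Uq q)" "\<And>c. uq_cls q (scal c) \<in> S"
    and mod: "uq_module scale q S \<rho>"
begin

lemma uq_cls_add_closed: "uq_cls q p \<in> S \<Longrightarrow> uq_cls q p' \<in> S \<Longrightarrow> uq_cls q (p + p') \<in> S"
  using subringE(7)[OF S(1)] by (simp add: uq_cls_add)

lemma uq_cls_mult_closed: "uq_cls q p \<in> S \<Longrightarrow> uq_cls q p' \<in> S \<Longrightarrow> uq_cls q (p * p') \<in> S"
  using subringE(6)[OF S(1)] by (simp add: uq_cls_mult)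

lemma uq_cls_uminus_closed: "uq_cls q p \<in> S \<Longrightarrow> uq_cls q (- p) \<in> S"
  using subringE(5)[OF S(1)] by (simp add: uq_cls_uminus)

lemma uq_cls_diff_closed: "uq_cls q p \<in> S \<Longrightarrow> uq_cls q p' \<in> S \<Longrightarrow> uq_cls q (p - p') \<in> S"
  using uq_cls_add_closed[OF _ uq_cls_uminus_closed, of p p'] by simp

lemmas uq_cls_closed = S(2) uq_cls_add_closed uq_cls_mult_closed uq_cls_diff_closed

lemma uq_module_linear: "u \<in> S \<Longrightarrow> Vector_Spaces.linear scale scale (\<rho> u)"
  using mod unfolding uq_module_def by (auto dest!: ring_hom_closed simp: End_ring_def)

lemma uq_module_add:
  "uq_cls q p \<in> S \<Longrightarrow> uq_cls q p' \<in> S \<Longrightarrow> \<rho> (uq_cls q (p + p')) v = \<rho> (uq_cls q p) v + \<rho> (uq_cls q p') v"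
  using mod ring_hom_add[of \<rho> "Uq q\<lparr>carrier := S\<rparr>" "End_ring scale" "uq_cls q p" "uq_cls q p'"]
  unfolding uq_module_def by (simp add: End_ring_def uq_cls_add)

lemma uq_module_mult:
  "uq_cls q p \<in> S \<Longrightarrow> uq_cls q p' \<in> S \<Longrightarrow> \<rho> (uq_cls q (p * p')) v = \<rho> (uq_cls q p) (\<rho> (uq_cls q p') v)"
  using mod ring_hom_mult[of \<rho> "Uq q\<lparr>carrier := S\<rparr>" "End_ring scale" "uq_cls q p" "uq_cls q p'"]
  unfolding uq_module_def by (simp add: End_ring_def uq_cls_mult)

lemma uq_module_scal: "\<rho> (uq_cls q (scal c)) v = scale c v"
  using mod unfolding uq_module_def by simp

lemma uq_module_1: "\<rho> (uq_cls q 1) v = v"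
  using mod ring_hom_one[of \<rho> "Uq q\<lparr>carrier := S\<rparr>" "End_ring scale"]
  unfolding uq_module_def by (simp add: End_ring_def uq_cls_1)

lemma uq_module_diff:
  assumes "uq_cls q p \<in> S" "uq_cls q p' \<in> S"
  shows "\<rho> (uq_cls q (p - p')) v = \<rho> (uq_cls q p) v - \<rho> (uq_cls q p') v"
  using uq_module_add[OF uq_cls_diff_closed[OF assms] assms(2), of v] by simp

lemmas uq_module_eval = uq_cls_closed uq_module_add uq_module_mult uq_module_scal uq_module_1 uq_module_diff

lemma uq_module_weyl:
  assumes "uq_cls q (gen g) \<in> S" "uq_cls q (gen h) \<in> S"
  shows "\<rho> (uq_cls q (uq_weyl q g h)) v = scale (inverse (q - inverse q))
    (scale q (\<rho> (uq_cls q (gen g)) (\<rho> (uq_cls q (gen h)) v))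
     - scale (inverse q) (\<rho> (uq_cls q (gen h)) (\<rho> (uq_cls q (gen g)) v)))"
  by (simp add: uq_weyl_def uq_module_eval assms)

end

text \<open>Both homomorphisms send scalars to scalar multiplication, so agreement on the three
  generators propagates through the inductive construction of the subring. Every element is
  represented as a class \<open>uq_cls q p\<close> to make the evaluation rules applicable.\<close>

lemma uq_module_eq_on_Uq_vee:
  assumes \<rho>: "uq_module scale q (Uq_vee q) \<rho>" and \<sigma>: "uq_module scale q (carrier (Uq q)) \<sigma>"
    and eq: "\<And>g. g \<in> {Gx, Gyinv, Gz} \<Longrightarrow> \<sigma> (uq_cls q (gen g)) = \<rho> (uq_cls q (gen g))"
    and "u \<in> Uq_vee q"
  shows "\<sigma> u = \<rho> u"
proof -
  have car: "uq_cls q p \<in> carrier (Uq q)" for p by (simp add: carrier_Uq)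
  note vee = subring_Uq_vee Uq_vee_scal \<rho>
  note full = ring.carrier_is_subring[OF ring_Uq] car \<sigma>
  have cls: "\<exists>p. w = uq_cls q p" if "w \<in> Uq_vee q" for w
    using that subringE(1)[OF subring_Uq_vee] by (auto simp: carrier_Uq)
  from \<open>u \<in> Uq_vee q\<close>[unfolded Uq_vee_def] show ?thesis
  proof (induction u rule: generate_ring.induct)
    case one
    show ?case
      using uq_module_1[OF vee] uq_module_1[OF full] by (simp add: fun_eq_iff uq_cls_1)
  next
    case (incl h)
    then show ?case
      using eq uq_module_scal[OF vee] uq_module_scal[OF full] by (auto simp: fun_eq_iff)
  next
    case (a_inv h)
    then obtain p where p: "h = uq_cls q p" "uq_cls q p \<in> Uq_vee q"
      using cls unfolding Uq_vee_def by blast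
    \<comment> \<open>Negation is rewritten as multiplication by the scalar -1, reducing this case
      to the rules for products and scalars.\<close>
    have "\<ominus>\<^bsub>Uq q\<^esub> h = uq_cls q (scal (- 1) * p)"
      by (simp add: p uq_cls_uminus scal_uminus scal_1)
    then show ?case
      using a_inv.IH p by (simp add: fun_eq_iff car uq_module_mult[OF vee] uq_module_mult[OF full]
          Uq_vee_scal uq_module_scal[OF vee] uq_module_scal[OF full])
  next
    case (eng_add h1 h2)
    then obtain p1 p2 where p: "h1 = uq_cls q p1" "uq_cls q p1 \<in> Uq_vee q"
      "h2 = uq_cls q p2" "uq_cls q p2 \<in> Uq_vee q"
      using cls unfolding Uq_vee_def by metis
    then show ?case
      using eng_add.IH uq_module_add[OF vee, of p1 p2] uq_module_add[OF full car car, of p1 p2]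
      by (simp add: fun_eq_iff uq_cls_add)
  next
    case (eng_mult h1 h2)
    then obtain p1 p2 where p: "h1 = uq_cls q p1" "uq_cls q p1 \<in> Uq_vee q"
      "h2 = uq_cls q p2" "uq_cls q p2 \<in> Uq_vee q"
      using cls unfolding Uq_vee_def by metis
    then show ?case
      using eng_mult.IH uq_module_mult[OF vee, of p1 p2] uq_module_mult[OF full car car, of p1 p2]
      by (simp add: fun_eq_iff uq_cls_mult)
  qed
qed

section \<open>Modules from operators that satisfy the relations\<close>

definition free_eval ::
  "('f::field \<Rightarrow> 'v::ab_group_add \<Rightarrow> 'v) \<Rightarrow> (uq_gen \<Rightarrow> 'v \<Rightarrow> 'v) \<Rightarrow> 'f uq_free \<Rightarrow> 'v \<Rightarrow> 'v" where
  "free_eval scale f p v = (\<Sum>w\<in>Poly_Mapping.keys p. scale (Poly_Mapping.lookup p w) (foldr f (letters w) v))"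

lemma poly_mapping_monomial_induct [case_names single add]:
  assumes single: "\<And>k c. P (Poly_Mapping.single k c)"
    and add: "\<And>p p'. P p \<Longrightarrow> P p' \<Longrightarrow> P (p + p')"
  shows "P (p :: 'k \<Rightarrow>\<^sub>0 'c::comm_monoid_add)"
proof (induction p rule: update_induct)
  case const
  show ?case using single[of _ 0] by simp
next
  case (update f k c)
  \<comment> \<open>The key \<open>k\<close> lies outside the support of \<open>f\<close>, so the
    update amounts to adding a monomial.\<close>
  have "Poly_Mapping.update k c f = f + Poly_Mapping.single k c"
    using update(1)
    by (intro poly_mapping_eqI) (auto simp: lookup_update lookup_add lookup_single in_keys_iff when_def)
  then show ?case using update single add by metis
qed

context vector_space
begin

lemma free_eval_single:
  "free_eval scale f (Poly_Mapping.single w c) v = scale c (foldr f (letters w) v)"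
  by (cases "c = 0") (simp_all add: free_eval_def)

lemma free_eval_superset:
  assumes "finite S" and "Poly_Mapping.keys p \<subseteq> S"
  shows "free_eval scale f p v = (\<Sum>w\<in>S. scale (Poly_Mapping.lookup p w) (foldr f (letters w) v))"
  unfolding free_eval_def
  using assms by (intro sum.mono_neutral_left) (auto simp: in_keys_iff)

lemma free_eval_add: "free_eval scale f (p + p') v = free_eval scale f p v + free_eval scale f p' v"
proof -
  let ?S = "Poly_Mapping.keys p \<union> Poly_Mapping.keys p'"
  have "Poly_Mapping.keys (p + p') \<subseteq> ?S" by (rule keys_add)
  then show ?thesis
    by (simp add: free_eval_superset[of ?S] lookup_add scale_left_distrib sum.distrib)
qed

lemma free_eval_scal: "free_eval scale f (scal c) v = scale c v"
  by (simp add: scal_def free_eval_single zero_uq_word_def)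

lemma free_eval_0: "free_eval scale f 0 v = 0"
  by (simp add: free_eval_def)

lemma free_eval_1: "free_eval scale f 1 v = v"
  using free_eval_scal[of f 1 v] by (simp add: scal_1)

lemma free_eval_gen: "free_eval scale f (gen g) v = f g v"
  by (simp add: gen_def free_eval_single)

lemma free_eval_uminus: "free_eval scale f (- p) v = - free_eval scale f p v"
  using free_eval_add[of f p "- p" v] by (simp add: free_eval_0 eq_neg_iff_add_eq_0 add.commute)

lemma free_eval_diff: "free_eval scale f (p - p') v = free_eval scale f p v - free_eval scale f p' v"
  using free_eval_add[of f p "- p'" v] by (simp add: free_eval_uminus)

context
  fixes f :: "uq_gen \<Rightarrow> 'b \<Rightarrow> 'b"
  assumes lin: "\<And>g. Vector_Spaces.linear scale scale (f g)"
begin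

lemma linear_foldr: "Vector_Spaces.linear scale scale (foldr f gs)"
proof (induction gs)
  case Nil
  show ?case by unfold_locales simp_all
next
  case (Cons g gs)
  show ?case using Vector_Spaces.linear_compose[OF Cons lin[of g]] by (simp add: o_def)
qed

lemma linear_free_eval: "Vector_Spaces.linear scale scale (free_eval scale f p)"
proof -
  interpret L: Vector_Spaces.linear scale scale "foldr f gs" for gs by (rule linear_foldr)
  show ?thesis
    by unfold_locales
      (simp_all add: free_eval_def L.add L.scale scale_right_distrib sum.distrib scale_sum_right mult.commute)
qed

text \<open>Both sides are additive in \<open>p\<close> and in \<open>p'\<close>, which leaves two
  monomials. There, concatenation of words becomes composition of the folds, and linearity moves the
  inner coefficient out.\<close>

lemma free_eval_mult: "free_eval scale f (p * p') v = free_eval scale f p (free_eval scale f p' v)"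
proof (induction p rule: poly_mapping_monomial_induct)
  case (add p1 p2)
  then show ?case by (simp add: distrib_right free_eval_add)
next
  case (single w c)
  interpret L: Vector_Spaces.linear scale scale "foldr f gs" for gs by (rule linear_foldr)
  show ?case
  proof (induction p' rule: poly_mapping_monomial_induct)
    case (add p1 p2)
    then show ?case by (simp add: distrib_left free_eval_add free_eval_single L.add scale_right_distrib)
  qed (simp add: mult_single free_eval_single plus_uq_word_def L.scale)
qed

lemma free_eval_weyl:
  "free_eval scale f (uq_weyl q g h) v =
    scale (inverse (q - inverse q)) (scale q (f g (f h v)) - scale (inverse q) (f h (f g v)))"
  by (simp add: uq_weyl_def free_eval_mult free_eval_diff free_eval_scal free_eval_gen)

text \<open>The polynomials that act as zero form a two-sided ideal. Containing the relators, it
  contains \<open>uq_ideal q\<close>, so evaluation descends to the quotient.\<close>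

lemma uq_module_of_generators:
  assumes rel: "\<And>p v. p \<in> uq_relators q \<Longrightarrow> free_eval scale f p v = 0"
  shows "\<exists>\<sigma>. uq_module scale q (carrier (Uq q)) \<sigma> \<and> (\<forall>p. \<sigma> (uq_cls q p) = free_eval scale f p)"
proof -
  \<comment> \<open>An arbitrary representative is chosen. Independence of the choice follows below,
    since two representatives differ by an element of the ideal and hence act alike.\<close>
  define \<sigma> where "\<sigma> u = free_eval scale f (SOME p. uq_cls q p = u)" for u
  let ?ker = "{p. \<forall>v. free_eval scale f p v = 0}"
  interpret E: Vector_Spaces.linear scale scale "free_eval scale f p" for p by (rule linear_free_eval)
  have "ideal ?ker free_algebra"
  proof (rule idealI[OF ring_free_algebra])
    interpret G: group "add_monoid (free_algebra :: 'a uq_free ring)"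
      by (rule abelian_group.a_group[OF ring.is_abelian_group[OF ring_free_algebra]])
    have inv: "inv\<^bsub>add_monoid free_algebra\<^esub> p = - p" for p :: "'a uq_free"
      by (rule G.inv_equality) simp_all
    show "subgroup ?ker (add_monoid free_algebra)"
    proof (rule G.subgroupI)
      show "inv\<^bsub>add_monoid free_algebra\<^esub> p \<in> ?ker" if "p \<in> ?ker" for p
        using that unfolding inv by (simp add: free_eval_uminus)
    qed (auto simp: free_eval_add free_eval_0 intro!: exI[of _ 0])
  qed (auto simp: free_eval_mult E.zero)
  then have ker: "uq_ideal q \<subseteq> ?ker"
    unfolding uq_ideal_def using rel by (intro ring.genideal_minimal[OF ring_free_algebra]) auto
  have \<sigma>: "\<sigma> (uq_cls q p) = free_eval scale f p" for p
  proof -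
    have "uq_cls q (SOME p'. uq_cls q p' = uq_cls q p) = uq_cls q p" by (rule someI) simp
    then have "(SOME p'. uq_cls q p' = uq_cls q p) - p \<in> ?ker"
      using ker uq_cls_eq_iff by blast
    then show ?thesis by (auto simp: \<sigma>_def free_eval_diff)
  qed
  have "\<sigma> \<in> ring_hom (Uq q) (End_ring scale)"
    by (rule ring_hom_memI)
      (auto simp: carrier_Uq End_ring_def \<sigma> linear_free_eval free_eval_add free_eval_mult free_eval_1
        fun_eq_iff simp flip: uq_cls_add uq_cls_mult uq_cls_1)
  then have "uq_module scale q (carrier (Uq q)) \<sigma>"
    by (auto simp: uq_module_def \<sigma> free_eval_scal fun_eq_iff)
  with \<sigma> show ?thesis by blast
qed

end

end

section \<open>Invertibility of the action of $y^{-1}$\<close>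

text \<open>If the first claim failed, the two summands of \<open>\<theta> m\<close> would be those
  of \<open>\<theta> n\<close> in the opposite order, making the eigenvalues equal. The second claim
  holds because \<open>q powi (int d - 2 * int m)\<close> determines
  \<open>\<theta> m\<close>.\<close>

lemma q_powi_eigenvalue_collision:
  fixes q a :: "'f::field" and d :: nat and \<theta> :: "nat \<Rightarrow> 'f"
  assumes "q \<noteq> 0" "a \<noteq> 0" and inj: "inj_on \<theta> {..d}"
    and \<theta>: "\<And>i. i \<le> d \<Longrightarrow> \<theta> i = a * q powi (int d - 2 * int i) + inverse a * q powi (2 * int i - int d)"
    and mn: "m \<le> d" "n \<le> d" "m \<noteq> n"
  shows "a\<^sup>2 \<noteq> q powi (2 * (int m + int n - int d))"
    and "q powi (int d - 2 * int m) \<noteq> q powi (int d - 2 * int n)"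
proof -
  have neg: "q powi (2 * int i - int d) = inverse (q powi (int d - 2 * int i))" for i
    by (simp flip: power_int_minus)
  show "q powi (int d - 2 * int m) \<noteq> q powi (int d - 2 * int n)"
  proof
    assume "q powi (int d - 2 * int m) = q powi (int d - 2 * int n)"
    then have "\<theta> m = \<theta> n" using mn by (simp add: \<theta> neg)
    then show False using inj mn by (auto dest: inj_onD)
  qed
  show "a\<^sup>2 \<noteq> q powi (2 * (int m + int n - int d))"
  proof
    assume a2: "a\<^sup>2 = q powi (2 * (int m + int n - int d))"
    have swap: "inverse a * q powi (2 * int i - int d) = a * q powi (int d - 2 * int j)"
      if "i + j = m + n" for i j
    proof -
      have e: "2 * (int m + int n - int d) + (int d - 2 * int j) = 2 * int i - int d"
        using arg_cong[OF that, of int] by simp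
      have "a\<^sup>2 * q powi (int d - 2 * int j) = q powi (2 * int i - int d)"
        unfolding a2 e[symmetric] by (rule power_int_add[symmetric]) (simp add: \<open>q \<noteq> 0\<close>)
      then show ?thesis using \<open>a \<noteq> 0\<close> by (simp add: field_simps power2_eq_square)
    qed
    have "\<theta> m = \<theta> n"
      using mn swap[of m n] swap[of n m] by (simp add: \<theta> add.commute)
    then show False using inj mn by (auto dest: inj_onD)
  qed
qed

context vector_space
begin

text \<open>By irreducibility the line through a common eigenvector is the whole space, so
  \<open>A\<close> has only one eigenvalue.\<close>

lemma tridiagonal_pair_common_eigenvector:
  assumes pair: "tridiagonal_pair scale A A'"
    and v: "v \<noteq> 0" "A v = scale t v" "A' v = scale t' v"
    and u: "u \<noteq> 0" "A u = scale s u"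
  shows "s = t"
proof -
  interpret A: Vector_Spaces.linear scale scale A using pair unfolding tridiagonal_pair_def by blast
  interpret A': Vector_Spaces.linear scale scale A' using pair unfolding tridiagonal_pair_def by blast
  have "A ` span {v} \<subseteq> span {v}" "A' ` span {v} \<subseteq> span {v}"
    by (auto simp: span_singleton A.scale A'.scale v mult.commute)
  moreover have "span {v} \<noteq> {0}" using v(1) span_base[of v "{v}"] by auto
  moreover have "subspace (span {v})" by (rule subspace_span)
  ultimately have "span {v} = UNIV" using pair unfolding tridiagonal_pair_def by blast
  then obtain c where "u = scale c v" unfolding span_singleton by blast
  then have "A u = scale t u" by (simp add: A.scale v mult.commute)
  then show ?thesis using u by simp
qed

text \<open>Intended for \<open>W\<close> the kernel of the action of the inverse of y, where
  \<open>B\<close> acts as \<open>a\<^sup>2\<close> times \<open>K\<close>. A nonzero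
  \<open>W\<close> would yield a vector in one component of each split decomposition, and comparing
  eigenvalues confines the two indices to opposite ends.\<close>

lemma kernel_trivial_of_split_actions:
  assumes "q \<noteq> 0" "a \<noteq> 0" and pair: "tridiagonal_pair scale A A'"
    and VA: "tridiagonal_ordering scale A A' d V"
    and VA': "tridiagonal_ordering scale A' A d V'"
    and V: "\<And>i. i \<le> d \<Longrightarrow> V i = eigenspace scale A (\<theta> i)"
    and V': "\<And>i. i \<le> d \<Longrightarrow> V' i = eigenspace scale A' (\<theta>' i)"
    and "d \<ge> 1"
    and inj: "inj_on \<theta> {..d}"
    and \<theta>: "\<And>i. i \<le> d \<Longrightarrow> \<theta> i = a * q powi (int d - 2 * int i) + inverse a * q powi (2 * int i - int d)"
    and K: "Vector_Spaces.linear scale scale K"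
    and KU: "\<And>i v. i \<le> d \<Longrightarrow> v \<in> split_U scale d V V' i \<Longrightarrow>
           K v = scale (q powi (int d - 2 * int i)) v"
    and B: "Vector_Spaces.linear scale scale B"
    and BU: "\<And>i v. i \<le> d \<Longrightarrow> v \<in> split_U_down scale d V V' i \<Longrightarrow>
           B v = scale (q powi (int d - 2 * int i)) v"
    and W: "subspace W" "\<And>v. v \<in> W \<Longrightarrow> K v \<in> W" "\<And>v. v \<in> W \<Longrightarrow> B v = scale (a\<^sup>2) (K v)"
  shows "W \<subseteq> {0}"
proof
  interpret B: Vector_Spaces.linear scale scale B by (rule B)
  fix w assume w: "w \<in> W"
  show "w \<in> {0}"
  proof (rule ccontr)
    assume "w \<notin> {0}"
    let ?Q = "\<lambda>i. q powi (int d - 2 * int i)"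
    let ?Vr = "\<lambda>i. V (d - i)"
    have Q_inj: "inj_on ?Q {..d}"
      using q_powi_eigenvalue_collision(2)[OF \<open>q \<noteq> 0\<close> \<open>a \<noteq> 0\<close> inj \<theta>] by (intro inj_onI) auto
    have up: "span (\<Union>i\<le>d. split_U scale d V V' i) = UNIV"
      by (rule split_U_span[OF pair VA VA' V V'])
    \<comment> \<open>The second decomposition is the first one for the reversed ordering of the
      eigenspaces of \<open>A\<close>.\<close>
    have down: "span (\<Union>i\<le>d. split_U scale d ?Vr V' i) = UNIV"
      by (rule split_U_span[OF pair tridiagonal_ordering_rev[OF VA]])
        (use VA' V V' in auto)
    obtain u i where u: "u \<in> W" "u \<noteq> 0" and i: "i \<in> {..d}" and Ku: "K u = scale (?Q i) u"
      by (rule eigenvector_in_invariant_subspace[where c = ?Q and W = W and w = w, OF K _ up])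
        (use KU W w \<open>w \<notin> {0}\<close> in auto)
    have uU: "u \<in> split_U scale d V V' i"
      by (rule eigenvector_in_component[OF K _ up _ subspace_split_U Q_inj i Ku]) (use KU in auto)
    have Bu: "B u = scale (a\<^sup>2 * ?Q i) u" using W(3)[OF u(1)] by (simp add: Ku)
    have BU': "B v = scale (?Q j) v" if "j \<in> {..d}" "v \<in> split_U scale d ?Vr V' j" for j v
      using that BU[of j v] by (simp add: split_U_rev)
    \<comment> \<open>Applying the eigenvector lemma to the line through \<open>u\<close> shows that
      the eigenvalue of \<open>B\<close> at \<open>u\<close> is one of the expected powers of
      \<open>q\<close>.\<close>
    obtain u' j where u': "u' \<in> span {u}" "u' \<noteq> 0" and j: "j \<in> {..d}" and Bu': "B u' = scale (?Q j) u'"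
    proof (rule eigenvector_in_invariant_subspace[where W = "span {u}" and w = u, OF B _ down BU'])
      show "B v \<in> span {u}" if "v \<in> span {u}" for v
        using that by (auto simp: span_singleton B.scale Bu)
    qed (use u span_base[of u "{u}"] in auto)
    have "B u' = scale (a\<^sup>2 * ?Q i) u'"
      using u'(1) unfolding span_singleton by (auto simp: B.scale Bu mult.commute)
    then have eig: "a\<^sup>2 * ?Q i = ?Q j" using Bu' u' by simp
    have uU': "u \<in> split_U scale d ?Vr V' j"
      by (rule eigenvector_in_component[OF B _ down BU' subspace_split_U Q_inj j])
        (use Bu eig in auto)
    have "?Q i * q powi (2 * (int i - int j)) = ?Q j"
      using \<open>q \<noteq> 0\<close> by (simp add: algebra_simps flip: power_int_add)
    then have a2: "a\<^sup>2 = q powi (2 * (int i - int j))"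
      using eig \<open>q \<noteq> 0\<close> by (metis mult.commute mult_right_cancel power_int_not_zero)
    \<comment> \<open>Away from the corners, \<open>i - j\<close> can be written as
      \<open>m + n - d\<close> with distinct \<open>m\<close> and \<open>n\<close> in the index
      range, which the collision lemma excludes. The pair is \<open>0, d + i - j\<close> if
      \<open>i \<le> j\<close> and \<open>d, i - j\<close> otherwise; its members coincide exactly
      at a corner.\<close>
    have corner: "i = d \<and> j = 0 \<or> i = 0 \<and> j = d"
    proof (rule ccontr)
      assume neg: "\<not> (i = d \<and> j = 0 \<or> i = 0 \<and> j = d)"
      note collision = q_powi_eigenvalue_collision(1)[OF \<open>q \<noteq> 0\<close> \<open>a \<noteq> 0\<close> inj \<theta>]
      show False
      proof (cases "i \<le> j")
        case True
        then have "d + i - j \<le> d" "0 \<noteq> d + i - j" "int 0 + int (d + i - j) - int d = int i - int j"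
          using i j neg by auto
        then show False using collision[of 0 "d + i - j"] a2 by simp
      next
        case False
        then have "i - j \<le> d" "d \<noteq> i - j" "int d + int (i - j) - int d = int i - int j"
          using i j neg by auto
        then show False using collision[of d "i - j"] a2 by simp
      qed
    qed
    have sub: "subspace (V k)" "subspace (V' k)" if "k \<le> d" for k
    proof -
      have "subspace (eigenspace scale T t)" if "Vector_Spaces.linear scale scale T" for T t
      proof -
        interpret T: Vector_Spaces.linear scale scale T by fact
        show ?thesis
          by (auto simp: eigenspace_def subspace_def T.zero T.add T.scale scale_right_distrib mult.commute)
      qed
      then show "subspace (V k)" "subspace (V' k)"
        using that V V' pair unfolding tridiagonal_pair_def by auto
    qed
    \<comment> \<open>At a corner, one component lies in \<open>V' 0\<close> and the other in a
      single end eigenspace of \<open>A\<close>: in \<open>V d\<close> for \<open>i = d\<close>,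
      \<open>j = 0\<close>, and in \<open>V 0\<close> for \<open>i = 0\<close>,
      \<open>j = d\<close>.\<close>
    have "u \<in> V' 0 \<and> (u \<in> V 0 \<or> u \<in> V d)"
      using corner uU uU' by (auto simp: split_U_def span_eq_iff[THEN iffD2, OF sub(1)] span_eq_iff[THEN iffD2, OF sub(2)])
    then obtain k where k: "k \<le> d" "k = 0 \<or> k = d" "A u = scale (\<theta> k) u" "A' u = scale (\<theta>' 0) u"
      using V V' by (auto simp: eigenspace_def)
    \<comment> \<open>The eigenspace at the opposite end supplies a second eigenvalue of
      \<open>A\<close>, distinct from the first since \<open>d \<ge> 1\<close>.\<close>
    have "V (d - k) \<noteq> {0}" by (rule tridiagonal_ordering_nonzero[OF VA]) simp
    moreover have "0 \<in> V (d - k)" using subspace_0[OF sub(1)] by simp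
    ultimately obtain x where "x \<noteq> 0" "x \<in> V (d - k)" by blast
    then have "\<theta> (d - k) = \<theta> k"
      using tridiagonal_pair_common_eigenvector[OF pair u(2) k(3,4)] V[of "d - k"]
      by (simp add: eigenspace_def)
    then show False
      using inj_onD[OF inj, of "d - k" k] k \<open>d \<ge> 1\<close> by auto
  qed
qed

end

context vector_space
begin

section \<open>The Bockting operator in terms of y and z\<close>

text \<open>Put \<open>M = L o K^-1\<close>. Then \<open>I - B K^-1\<close> is
  \<open>(1 - a^2) (I - M)\<close> and \<open>a I - a^-1 B K^-1\<close> is
  \<open>- a^-1 (1 - a^2) M\<close>. In the quotient the factor \<open>1 - a^2\<close> cancels, and
  the inverse of \<open>M\<close> is \<open>K o Y\<close>.\<close>

lemma bockting_eq:
  assumes K: "Vector_Spaces.linear scale scale K" "bij K"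
    and L: "Vector_Spaces.linear scale scale L" and LY: "\<And>v. L (Y v) = v" and YL: "\<And>v. Y (L v) = v"
    and a: "a \<noteq> 0" "a\<^sup>2 \<noteq> 1"
    and B: "\<And>v. B v = scale (a\<^sup>2) (K v) + scale (1 - a\<^sup>2) (L v)"
  shows "bockting scale q a K B v = scale (a * inverse q) (v - K (Y v))"
proof -
  interpret K: Vector_Spaces.linear scale scale K by (rule K)
  interpret L: Vector_Spaces.linear scale scale L by (rule L)
  define c where "c = inverse a * (1 - a\<^sup>2)"
  define R where "R = (\<lambda>v. scale a v - scale (inverse a) (B (inv_into UNIV K v)))"
  define M where "M = (\<lambda>v. L (inv_into UNIV K v))"
  have K_inv: "K (inv_into UNIV K v) = v" "inv_into UNIV K (K v) = v" for v
    using K(2) by (simp_all add: bij_is_surj bij_is_inj surj_f_inv_f)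
  have BK: "B (inv_into UNIV K v) = scale (a\<^sup>2) v + scale (1 - a\<^sup>2) (M v)" for v
    by (simp add: B M_def K_inv)
  have R: "R v = - scale c (M v)" for v
    using a(1) by (simp add: R_def c_def BK scale_right_distrib power2_eq_square)
  have c: "c \<noteq> 0" using a by (simp add: c_def)
  have KYM: "K (Y (M v)) = v" for v
    by (simp add: M_def K_inv LY YL)
  have "inj R"
  proof (rule injI)
    fix u w assume "R u = R w"
    then have "M u = M w" using c by (simp add: R)
    then show "u = w" by (metis KYM)
  qed
  \<comment> \<open>The preimage of \<open>v\<close> under \<open>R\<close>, read off from
    \<open>R = - c M\<close> and the inverse \<open>K o Y\<close> of \<open>M\<close>.\<close>
  let ?r = "scale (- inverse c) (K (Y v))"
  have M_r: "M ?r = scale (- inverse c) v"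
  proof -
    have "?r = K (scale (- inverse c) (Y v))" by (simp only: K.scale)
    then show ?thesis by (simp only: M_def K_inv L.scale LY)
  qed
  have "R ?r = - scale c (scale (- inverse c) v)"
    by (simp only: R M_r)
  then have "R ?r = v" using c by simp
  then have "inv_into UNIV R v = ?r" by (rule inv_f_eq[OF \<open>inj R\<close>])
  then have "bockting scale q a K B v = scale (inverse q) (?r - B (inv_into UNIV K ?r))"
    unfolding bockting_def Let_def R_def by simp
  also have "?r - B (inv_into UNIV K ?r) = scale (1 - a\<^sup>2) (?r - M ?r)"
    by (simp add: BK algebra_simps)
  also have "\<dots> = scale (- (1 - a\<^sup>2) * inverse c) (K (Y v) - v)"
    by (simp only: M_r scale_right_diff_distrib scale_scale mult_minus_left mult_minus_right)
  also have "- (1 - a\<^sup>2) * inverse c = - a"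
    using a by (simp add: c_def field_simps)
  finally show ?thesis by (simp add: algebra_simps)
qed

end

section \<open>Extension of the module and the action of \<open>uq_nu_x\<close>\<close>

theorem proposition12p9:
  fixes scale :: "'f::field \<Rightarrow> 'v::ab_group_add \<Rightarrow> 'v"
    and Basis :: "'v set"
    and q a b :: 'f
    and d :: nat
    and A A' K B :: "'v \<Rightarrow> 'v"
    and V V' :: "nat \<Rightarrow> 'v set"
    and \<theta> \<theta>' :: "nat \<Rightarrow> 'f"
    and \<rho> :: "'f uq_free set \<Rightarrow> 'v \<Rightarrow> 'v"
  assumes "q \<noteq> 0" and "q ^ 4 \<noteq> 1"
    and "finite_dimensional_vector_space scale Basis"
    and "vector_space.dim scale (UNIV :: 'v set) > 0"
    and "tridiagonal_pair scale A A'"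
    and "d \<ge> 1"
    and "tridiagonal_ordering scale A A' d V"
    and "tridiagonal_ordering scale A' A d V'"
    and "\<And>i. i \<le> d \<Longrightarrow> V i = eigenspace scale A (\<theta> i)"
    and "\<And>i. i \<le> d \<Longrightarrow> V' i = eigenspace scale A' (\<theta>' i)"
    and "a \<noteq> 0" and "b \<noteq> 0"
    and "\<And>i. i \<le> d \<Longrightarrow> \<theta> i = a * q powi (int d - 2 * int i) + inverse a * q powi (2 * int i - int d)"
    and "\<And>i. i \<le> d \<Longrightarrow> \<theta>' i = b * q powi (int d - 2 * int i) + inverse b * q powi (2 * int i - int d)"
    and "Vector_Spaces.linear scale scale K"
    and "\<And>i v. i \<le> d \<Longrightarrow> v \<in> split_U scale d V V' i \<Longrightarrow>
           K v = scale (q powi (int d - 2 * int i)) v"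
    and "Vector_Spaces.linear scale scale B"
    and "\<And>i v. i \<le> d \<Longrightarrow> v \<in> split_U_down scale d V V' i \<Longrightarrow>
           B v = scale (q powi (int d - 2 * int i)) v"
    and "uq_module scale q (Uq_vee q) \<rho>"
    and "\<rho> (uq_z q) = K" and "\<rho> (uq_Z q a) = B" and "\<rho> (uq_A q a) = A"
  shows "(\<exists>\<sigma>. uq_module scale q (carrier (Uq q)) \<sigma> \<and> (\<forall>u\<in>Uq_vee q. \<sigma> u = \<rho> u)) \<and>
    (\<forall>\<sigma>. uq_module scale q (carrier (Uq q)) \<sigma> \<and> (\<forall>u\<in>Uq_vee q. \<sigma> u = \<rho> u) \<longrightarrow>
      \<sigma> (uq_nu_x q) = (\<lambda>v. scale (inverse a) (bockting scale q a K B v)))"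
proof -
  interpret finite_dimensional_vector_space scale Basis by fact
  note q = assms(1,2) and pair = assms(5) and d = assms(6) and VA = assms(7) and VA' = assms(8)
    and V = assms(9) and V' = assms(10) and a = assms(11) and \<theta> = assms(13) and K = assms(15)
    and KU = assms(16) and B = assms(17) and BU = assms(18) and \<rho> = assms(19)
    and \<rho>z = assms(20) and \<rho>Z = assms(21)
  have s: "q - inverse q \<noteq> 0"
  proof
    assume "q - inverse q = 0"
    then have "q * q = 1" using q(1) by (simp add: field_simps)
    then have "q ^ 4 = 1" by (simp add: power4_eq_xxxx mult.assoc)
    with q(2) show False by simp
  qed
  have inj_\<theta>: "inj_on \<theta> {..d}"
  proof (rule inj_onI)
    fix i j assume ij: "i \<in> {..d}" "j \<in> {..d}" "\<theta> i = \<theta> j"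
    then have "V i = V j" by (simp add: V)
    moreover have "inj_on V {..d}"
      using VA unfolding tridiagonal_ordering_def by (blast dest: bij_betw_imp_inj_on)
    ultimately show "i = j" using ij by (auto dest: inj_onD)
  qed
  \<comment> \<open>The indices 0 and \<open>d\<close> are distinct and make the exponent in the
    collision lemma zero.\<close>
  have a2: "a\<^sup>2 \<noteq> 1"
    using q_powi_eigenvalue_collision(1)[OF q(1) a inj_\<theta> \<theta>, of 0 d] d by simp
  have bij_K: "bij K"
  proof (rule bij_of_nonzero_eigenvalues[OF K _ split_U_span[OF pair VA VA' V V']])
    show "K v = scale (q powi (int d - 2 * int i)) v" if "i \<in> {..d}" "v \<in> split_U scale d V V' i" for i v
      using KU that by simp
  qed (use q(1) in auto)

  let ?L = "\<rho> (uq_cls q (gen Gyinv))" and ?X = "\<rho> (uq_cls q (gen Gx))"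
  let ?s = "inverse (q - inverse q)"
  note vee = subring_Uq_vee Uq_vee_scal \<rho>
  note vee_simps = uq_module_eval[OF vee] Uq_vee_x Uq_vee_yinv Uq_vee_z
  have z: "\<rho> (uq_cls q (gen Gz)) = K" using \<rho>z by (simp add: uq_z_def)
  have Z: "B v = scale (a\<^sup>2) (K v) + scale (1 - a\<^sup>2) (?L v)" for v
    unfolding \<rho>Z[symmetric] uq_Z_def by (simp add: vee_simps z)
  have LX: "scale ?s (scale q (?L (?X v)) - scale (inverse q) (?X (?L v))) = ?L (?L v)" for v
    using uq_module_weyl[OF vee Uq_vee_yinv Uq_vee_x, of v]
    by (simp add: uq_cls_weyl_x_yinv uq_module_mult[OF vee] Uq_vee_yinv)
  have KL: "scale ?s (scale q (K (?L v)) - scale (inverse q) (?L (K v))) = ?L (?L v)" for v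
    using uq_module_weyl[OF vee Uq_vee_z Uq_vee_yinv, of v]
    by (simp add: uq_cls_weyl_yinv_z uq_module_mult[OF vee] Uq_vee_yinv z)
  have KX: "scale ?s (scale q (K (?X v)) - scale (inverse q) (?X (K v))) = v" for v
    using uq_module_weyl[OF vee Uq_vee_z Uq_vee_x, of v]
    by (simp add: uq_cls_weyl_zx uq_module_1[OF vee] z)
  interpret L: Vector_Spaces.linear scale scale ?L
    by (rule uq_module_linear[OF vee Uq_vee_yinv])
  interpret K: Vector_Spaces.linear scale scale K by (rule K)
  have "{v. ?L v = 0} \<subseteq> {0}"
  proof (rule kernel_trivial_of_split_actions[OF q(1) a pair VA VA' V V' d inj_\<theta> \<theta> K KU B BU])
    show "subspace {v. ?L v = 0}" by (rule L.subspace_kernel)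
    fix v assume v: "v \<in> {v. ?L v = 0}"
    \<comment> \<open>When \<open>?L v = 0\<close>, the relation \<open>KL\<close> leaves only a
      nonzero multiple of \<open>?L (K v)\<close>, which must then vanish.\<close>
    then show "K v \<in> {v. ?L v = 0}"
      using KL[of v] s q(1) by (simp add: K.zero L.zero)
    show "B v = scale (a\<^sup>2) (K v)" using v by (simp add: Z)
  qed
  then have inj_L: "inj ?L" using L.inj_iff_eq_0 by blast
  then have surj_L: "surj ?L" by (rule linear_inj_imp_surj[OF L.linear_axioms])
  define Y where "Y = inv_into UNIV ?L"
  have LY: "?L (Y v) = v" and YL: "Y (?L v) = v" for v
    unfolding Y_def using inj_L surj_L by (simp_all add: surj_f_inv_f)
  interpret Y: Vector_Spaces.linear scale scale Y
    unfolding Y_def by (rule inj_linear_imp_inv_linear[OF L.linear_axioms inj_L])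

  \<comment> \<open>The actions of x, z and the inverse of y are kept, so that the new module
    extends the old one; y acts as the inverse operator \<open>Y\<close>.\<close>
  define f where "f = case_uq_gen ?X Y ?L K"
  have f: "f Gx = ?X" "f Gy = Y" "f Gyinv = ?L" "f Gz = K" by (simp_all add: f_def)
  have lin_f: "Vector_Spaces.linear scale scale (f g)" for g
    using uq_module_linear[OF vee Uq_vee_x] by (cases g) (simp_all add: f Y.linear_axioms L.linear_axioms K)
  \<comment> \<open>The original relations for y are recovered by evaluating those for its inverse
    at \<open>Y v\<close> and then applying \<open>Y\<close>.\<close>
  have XY: "scale ?s (scale q (?X (Y v)) - scale (inverse q) (Y (?X v))) = v" for v
    using arg_cong[OF LX[of "Y v"], of Y] by (simp add: Y.scale Y.diff YL LY)
  have YK: "scale ?s (scale q (Y (K v)) - scale (inverse q) (K (Y v))) = v" for v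
    using arg_cong[OF KL[of "Y v"], of Y] by (simp add: Y.scale Y.diff YL LY)
  have rel: "free_eval scale f p v = 0" if "p \<in> uq_relators q" for p v
    using that unfolding uq_relators_def
    by (auto simp: free_eval_diff free_eval_1 free_eval_mult[OF lin_f] free_eval_gen
        free_eval_weyl[OF lin_f] f LY YL XY YK KX)
  obtain \<sigma> where \<sigma>: "uq_module scale q (carrier (Uq q)) \<sigma>"
    and \<sigma>_cls: "\<And>p. \<sigma> (uq_cls q p) = free_eval scale f p"
    using uq_module_of_generators[where f = f and q = q, OF lin_f rel] by blast
  have "\<sigma> u = \<rho> u" if "u \<in> Uq_vee q" for u
    by (rule uq_module_eq_on_Uq_vee[OF \<rho> \<sigma> _ that])
      (auto simp: \<sigma>_cls free_eval_gen f z fun_eq_iff)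
  moreover have "\<sigma>' (uq_nu_x q) = (\<lambda>v. scale (inverse a) (bockting scale q a K B v))"
    if \<sigma>': "uq_module scale q (carrier (Uq q)) \<sigma>'" "\<forall>u\<in>Uq_vee q. \<sigma>' u = \<rho> u" for \<sigma>'
  proof
    fix v
    have car: "uq_cls q p \<in> carrier (Uq q)" for p by (simp add: carrier_Uq)
    note full = ring.carrier_is_subring[OF ring_Uq] car \<sigma>'(1)
    let ?Y = "\<sigma>' (uq_cls q (gen Gy))"
    have L': "\<sigma>' (uq_cls q (gen Gyinv)) = ?L" and z': "\<sigma>' (uq_cls q (gen Gz)) = K"
      using \<sigma>'(2) Uq_vee_yinv Uq_vee_z z by auto
    have "?Y (?L v) = v" for v
      using uq_module_mult[OF full car car, of "gen Gy" "gen Gyinv" v]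
      by (simp add: uq_cls_y_yinv uq_module_1[OF full] L')
    \<comment> \<open>In any extension the action of y is forced, being inverse to that of its
      inverse. The formula thus holds for every extension.\<close>
    then have Y': "?Y = Y" by (metis LY ext)
    have "\<sigma>' (uq_nu_x q) v = scale q (v - Y (K v))"
      by (simp add: uq_nu_x_def uq_module_eval[OF full] car z' Y')
    moreover have "bockting scale q a K B v = scale (a * inverse q) (v - K (Y v))"
      by (rule bockting_eq[OF K bij_K L.linear_axioms LY YL a a2 Z])
    \<comment> \<open>The two expressions for \<open>uq_nu_x\<close>, with yz and with zy, agree by
      the relation \<open>YK\<close>; the Bockting formula produces the second.\<close>
    moreover have "scale q (v - Y (K v)) = scale (inverse q) (v - K (Y v))"
    proof -
      have "scale q (Y (K v)) - scale (inverse q) (K (Y v)) = scale (q - inverse q) v"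
        using arg_cong[OF YK[of v], of "scale (q - inverse q)"] s by simp
      then show ?thesis by (simp add: algebra_simps)
    qed
    ultimately show "\<sigma>' (uq_nu_x q) v = scale (inverse a) (bockting scale q a K B v)"
      using a by simp
  qed
  ultimately show ?thesis using \<sigma> by blast
qed

end
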